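(* Let $Y=(Y_t)_{t\ge0}$ be a one-dimensional Lévy process with characteristic exponent $$\Psi(u)=bu+\frac12\sigma^2u^2+\int_{-\infty}^\infty\left(e^{ur}-1-ur\,\mathbb{I}_{\{|r|\le1\}}\right)\Pi(dr),$$ and assume that $\sigma^2>0$ and $\Pi(0,\infty)=0$ (so that $\mathbb{E}[e^{uY_t}]=e^{t\Psi(u)}<\infty$ for all $u,t\ge0$). For $t>0$ let $f_t\in C^\infty(\mathbb{R})$ denote the smooth density of $Y_t$, $\mathbb{P}(Y_t\in dy)=f_t(y)\,dy$. Then, for any fixed $t>0$, as $y\to\infty$, $$f_t(t\Psi'(y))\ \sim\ \frac{1}{\sqrt{2\pi\sigma^2t}}\,\exp\left(-\frac12t\sigma^2y^2+ty^2\int_{-\infty}^0e^{yr}\,r\,\Pi(-\infty,r)\,dr\right).$$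
   Context: A Lévy process $Y=(Y_t)_{t\ge0}$ is an $\mathbb{R}$-valued stochastic process with stationary and independent increments, continuous in probability, with $Y_0=0$ almost surely. Here $b\in\mathbb{R}$, $\sigma\ge0$, and $\Pi$ is a $\sigma$-finite positive measure on $\mathbb{R}$ with $\Pi(\{0\})=0$ and $\int_{-\infty}^\infty\min(1,r^2)\,\Pi(dr)<\infty$. The exponent satisfies $\mathbb{E}[e^{uY_t}]=e^{t\Psi(u)}$ for $u\in i\mathbb{R}$, and under the stated assumptions it extends by the same formula to $\{\mathrm{Re}\,u\ge0\}$. It is known that when $\sigma^2>0$ the law of $Y_t$, $t>0$, has a $C^\infty(\mathbb{R})$ density. $\Pi(-\infty,r)$ is the $\Pi$-mass of the interval $(-\infty,r)$. $f(y)\sim g(y)$ means $\lim_{y\to\infty}f(y)/g(y)=1$. *)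

theory Defs
  imports "HOL-Probability.Probability"
begin

locale levy_process = prob_space M for M :: "'w measure" +
  fixes Y :: "real \<Rightarrow> 'w \<Rightarrow> real"
  assumes measurable_process: "\<And>t. t \<ge> 0 \<Longrightarrow> random_variable borel (Y t)"
    and starts_at_zero: "AE \<omega> in M. Y 0 \<omega> = 0"
    and stationary_increments:
      "\<And>s h. s \<ge> 0 \<Longrightarrow> h \<ge> 0 \<Longrightarrow>
         distr M borel (\<lambda>\<omega>. Y (s + h) \<omega> - Y s \<omega>) = distr M borel (\<lambda>\<omega>. Y h \<omega> - Y 0 \<omega>)"
    and independent_increments:
      "\<And>(\<tau> :: nat \<Rightarrow> real) n. \<tau> 0 \<ge> 0 \<Longrightarrow> mono_on {..n} \<tau> \<Longrightarrow>
         indep_vars (\<lambda>_. borel) (\<lambda>i \<omega>. Y (\<tau> (Suc i)) \<omega> - Y (\<tau> i) \<omega>) {..<n}"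
    and continuous_in_probability:
      "\<And>t \<epsilon>. t \<ge> 0 \<Longrightarrow> \<epsilon> > 0 \<Longrightarrow>
         ((\<lambda>s. prob {\<omega> \<in> space M. \<bar>Y s \<omega> - Y t \<omega>\<bar> > \<epsilon>}) \<longlongrightarrow> 0) (at t within {0..})"

definition levy_measure :: "real measure \<Rightarrow> bool" where
  "levy_measure \<nu> \<longleftrightarrow> sets \<nu> = sets borel \<and> sigma_finite_measure \<nu> \<and>
     emeasure \<nu> {0} = 0 \<and> (\<integral>\<^sup>+ r. ennreal (min 1 (r\<^sup>2)) \<partial>\<nu>) < \<infinity>"

(* Polymorphic, so that one formula serves both as the exponent at complex arguments and as its
   restriction to real arguments, whose derivative enters the asymptotics.  The Bochner integral
   is 0 when the integrand is not integrable; the integrand is integrable for Re u = 0, and for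
   Re u >= 0 if \<nu> has no mass on the positive half-line. *)
definition levy_exponent ::
  "real \<Rightarrow> real \<Rightarrow> real measure \<Rightarrow> 'a \<Rightarrow> 'a :: {real_normed_field, banach, second_countable_topology}"
where
  "levy_exponent b \<sigma> \<nu> u =
     of_real b * u + of_real (\<sigma>\<^sup>2) / 2 * u\<^sup>2 +
     (LINT r|\<nu>. exp (u * of_real r) - 1 - u * of_real r * indicator {-1..1} r)"

definition has_characteristic_exponent ::
  "'w measure \<Rightarrow> (real \<Rightarrow> 'w \<Rightarrow> real) \<Rightarrow> (complex \<Rightarrow> complex) \<Rightarrow> bool"
where
  "has_characteristic_exponent M Y \<Psi> \<longleftrightarrow>
     (\<forall>t\<ge>0. \<forall>u. Re u = 0 \<longrightarrow>
        (LINT \<omega>|M. exp (u * of_real (Y t \<omega>))) = exp (of_real t * \<Psi> u))"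

(* Nonnegativity is required separately because ennreal maps negative reals to 0. *)
definition smooth_density :: "'w measure \<Rightarrow> ('w \<Rightarrow> real) \<Rightarrow> (real \<Rightarrow> real) \<Rightarrow> bool" where
  "smooth_density M X f \<longleftrightarrow>
     (\<forall>x. f x \<ge> 0) \<and> (\<forall>n x. (deriv ^^ n) f differentiable (at x)) \<and>
     distributed M lborel X (\<lambda>x. ennreal (f x))"

end

theory Submission
  imports Defs "HOL-Complex_Analysis.Complex_Analysis"
begin

text \<open>
  By Fourier inversion, \<open>2\<pi> f\<^sub>t(x)\<close> is the integral of \<open>exp (t\<Psi>(u) - ux)\<close> along the imaginary axis
  (in the variable \<open>Im u\<close>).  The Gaussian part makes \<open>exp (t\<Psi>)\<close> decay rapidly in vertical strips, so
  the line of integration can be moved to the real part \<open>y\<close>.  For \<open>x = t\<Psi>'(y)\<close> the linear term of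
  the exponent vanishes, leaving the factor \<open>exp (t(\<Psi>(y) - y\<Psi>'(y)))\<close> times the integral of
  \<open>exp (t(R(y, \<theta>) - \<sigma>\<^sup>2\<theta>\<^sup>2/2))\<close> over \<open>\<theta>\<close>, where \<open>R(y, \<theta>)\<close> is the \<open>\<nu>\<close>-integral of
  \<open>exp (yr) (exp (\<i>\<theta>r) - 1 - \<i>\<theta>r)\<close>.  Since all jumps are negative, \<open>R(y, \<theta>)\<close> tends to 0 as
  \<open>y \<rightarrow> \<infinity>\<close>; its real part is nonpositive, so dominated convergence leaves a Gaussian integral.
  Finally, Fubini turns \<open>\<Psi>(y) - y\<Psi>'(y)\<close> into the integral of the tail of \<open>\<nu>\<close>.
\<close>

subsection \<open>Vertical contour integrals and Fourier inversion\<close>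

text \<open>Links the truncated integrals over \<open>{-T..T}\<close>, which contour integration and
  Levy inversion produce, to the Lebesgue integral over the line, by dominated convergence with
  majorant \<open>norm (f x)\<close>.\<close>

lemma integral_real_symmetric_intervals:
  fixes f :: "real \<Rightarrow> 'a::euclidean_space"
  assumes "integrable lborel f"
  shows "((\<lambda>T. integral {-T..T} f) \<longlongrightarrow> (LBINT x. f x)) at_top"
proof -
  have "((\<lambda>T. LBINT x. indicator {-T..T} x *\<^sub>R f x) \<longlongrightarrow> (LBINT x. f x)) at_top"
  proof (rule integral_dominated_convergence_at_top[where w = "\<lambda>x. norm (f x)"])
    show "AE x in lborel. ((\<lambda>T. indicat_real {-T..T} x *\<^sub>R f x) \<longlongrightarrow> f x) at_top"
    proof (rule AE_I2, rule tendsto_eventually)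
      show "\<forall>\<^sub>F T in at_top. indicat_real {-T..T} x *\<^sub>R f x = f x" for x :: real
        using eventually_ge_at_top[of "\<bar>x\<bar>"] by eventually_elim (auto split: split_indicator)
    qed
  qed (use assms in \<open>auto split: split_indicator\<close>)
  moreover have "(LBINT x. indicator {-T..T} x *\<^sub>R f x) = integral {-T..T} f" for T
    using set_borel_integral_eq_integral(2)[of "{-T..T}" f] integrable_mult_indicator[OF _ assms]
    by (simp add: set_lebesgue_integral_def set_integrable_def)
  ultimately show ?thesis by simp
qed

text \<open>Cauchy's theorem on the rectangle of height 2T: each horizontal side contributes at most
  (b - a) times \<open>g T\<close> or \<open>g (-T)\<close>, which vanishes as T grows.
  Differentiability is asked for in the open strip only, so that the imaginary axis, where the
  exponent is merely shown to be continuous, may serve as an edge.\<close>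

lemma vertical_contour_shift:
  fixes F :: "complex \<Rightarrow> complex" and g :: "real \<Rightarrow> real"
  assumes "a < b"
    and cont: "continuous_on {z. a \<le> Re z \<and> Re z \<le> b} F"
    and diff: "\<And>z. a < Re z \<Longrightarrow> Re z < b \<Longrightarrow> F field_differentiable at z"
    and bound: "\<And>z. a \<le> Re z \<Longrightarrow> Re z \<le> b \<Longrightarrow> norm (F z) \<le> g (Im z)"
    and g: "integrable lborel g" "(g \<longlongrightarrow> 0) at_top" "(g \<longlongrightarrow> 0) at_bot"
  shows "(LBINT y. F (Complex a y)) = (LBINT y. F (Complex b y))"
proof -
  let ?V = "\<lambda>c T. integral {-T..T} (\<lambda>y. F (Complex c y))"
  have rect: "norm (?V b T - ?V a T) \<le> (b - a) * (g T + g (-T))" if "T > 0" for T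
  proof -
    let ?p = "Complex a (-T)" and ?q = "Complex b (-T)" and ?r = "Complex b T" and ?s = "Complex a T"
    have sub: "cbox ?p ?r \<subseteq> {z. a \<le> Re z \<and> Re z \<le> b}"
      by (auto simp: in_cbox_complex_iff)
    have seg: "closed_segment u v \<subseteq> cbox ?p ?r"
      if "u \<in> cbox ?p ?r" "v \<in> cbox ?p ?r" for u v
      using that by (simp add: closed_segment_subset)
    have corners: "?p \<in> cbox ?p ?r" "?q \<in> cbox ?p ?r" "?r \<in> cbox ?p ?r" "?s \<in> cbox ?p ?r"
      using \<open>a < b\<close> \<open>T > 0\<close> by (auto simp: in_cbox_complex_iff)
    have int: "F contour_integrable_on linepath u v" if "u \<in> cbox ?p ?r" "v \<in> cbox ?p ?r" for u v
      by (intro contour_integrable_continuous_linepath continuous_on_subset[OF cont]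
            subset_trans[OF seg sub] that)
    \<comment> \<open>This form of Cauchy's theorem asks for continuity on the closed rectangle and
      holomorphy in its interior, so the vertical sides may lie on the edges of the strip.\<close>
    have "(F has_contour_integral 0)
        (linepath ?p ?q +++ linepath ?q ?r +++ linepath ?r ?s +++ linepath ?s ?p)"
    proof (rule Cauchy_theorem_convex[where S = "cbox ?p ?r" and K = "{}"])
      show "continuous_on (cbox ?p ?r) F" by (rule continuous_on_subset[OF cont sub])
      show "F field_differentiable at x" if "x \<in> interior (cbox ?p ?r) - {}" for x
        using that by (intro diff) (auto simp: in_box_complex_iff)
    qed (use seg corners in \<open>auto simp: path_image_join\<close>)
    then have "contour_integral (linepath ?p ?q) F + contour_integral (linepath ?q ?r) F +
        contour_integral (linepath ?r ?s) F + contour_integral (linepath ?s ?p) F = 0"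
      by (rule has_chain_integral_chain_integral4)
    moreover have "contour_integral (linepath ?q ?r) F = \<i> * ?V b T"
      using \<open>T > 0\<close> by (intro contour_integral_linepath_same_Re) auto
    \<comment> \<open>The left side is traversed downwards, hence the minus sign.\<close>
    moreover have "contour_integral (linepath ?s ?p) F = - (\<i> * ?V a T)"
      using \<open>T > 0\<close> contour_integral_linepath_same_Re[of ?p a ?s "-T" T F]
        contour_integral_reverse_linepath[of ?p ?s F]
        continuous_on_subset[OF cont subset_trans[OF seg sub]]
        corners
      by (metis (no_types, lifting) add.inverse_inverse complex.sel neg_less_pos)
    ultimately have "\<i> * (?V b T - ?V a T) =
        - contour_integral (linepath ?p ?q) F - contour_integral (linepath ?r ?s) F"
      by (simp add: algebra_simps)
    then have "norm (?V b T - ?V a T) \<le>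
        norm (contour_integral (linepath ?p ?q) F) + norm (contour_integral (linepath ?r ?s) F)"
      by (smt (verit) mult_cancel_right1 norm_ii norm_minus_cancel norm_mult norm_triangle_ineq4 mult_1)
    moreover have "norm (contour_integral (linepath ?p ?q) F) \<le> g (-T) * norm (?q - ?p)"
    proof (rule contour_integral_bound_linepath[OF int])
      show "norm (F x) \<le> g (-T)" if "x \<in> closed_segment ?p ?q" for x
        using bound[of x] that seg[of ?p ?q] corners sub
        by (auto simp: closed_segment_same_Im)
      show "0 \<le> g (-T)"
        using bound[of ?p] \<open>a < b\<close> by (auto intro: order_trans[OF norm_ge_zero])
    qed (use corners in auto)
    moreover have "norm (contour_integral (linepath ?r ?s) F) \<le> g T * norm (?s - ?r)"
    proof (rule contour_integral_bound_linepath[OF int])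
      show "norm (F x) \<le> g T" if "x \<in> closed_segment ?r ?s" for x
        using bound[of x] that seg[of ?r ?s] corners sub
        by (auto simp: closed_segment_same_Im)
      show "0 \<le> g T"
        using bound[of ?s] \<open>a < b\<close> by (auto intro: order_trans[OF norm_ge_zero])
    qed (use corners in auto)
    moreover have "norm (?q - ?p) = b - a" "norm (?s - ?r) = b - a"
      using \<open>a < b\<close> by (auto simp: cmod_def)
    ultimately show ?thesis by (simp add: algebra_simps)
  qed
  have integrable: "integrable lborel (\<lambda>y. F (Complex c y))" if "a \<le> c" "c \<le> b" for c
  proof (rule Bochner_Integration.integrable_bound[OF g(1)])
    have "continuous_on UNIV (\<lambda>y. F (Complex c y))"
      unfolding Complex_eq using that
      by (intro continuous_on_compose2[OF cont] continuous_intros) auto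
    then show "(\<lambda>y. F (Complex c y)) \<in> borel_measurable lborel"
      by (simp add: borel_measurable_continuous_onI)
    show "AE y in lborel. norm (F (Complex c y)) \<le> norm (g y)"
      using bound[of "Complex c _"] that by (auto intro: order_trans[OF _ abs_ge_self])
  qed
  have "((\<lambda>T. ?V b T - ?V a T) \<longlongrightarrow> (LBINT y. F (Complex b y)) - (LBINT y. F (Complex a y))) at_top"
    using \<open>a < b\<close> by (intro tendsto_diff integral_real_symmetric_intervals integrable) auto
  moreover have "((\<lambda>T. ?V b T - ?V a T) \<longlongrightarrow> 0) at_top"
  proof (rule Lim_null_comparison)
    show "\<forall>\<^sub>F T in at_top. norm (?V b T - ?V a T) \<le> (b - a) * (g T + g (-T))"
      using eventually_gt_at_top[of 0] by eventually_elim (rule rect)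
    have "((\<lambda>T. g (-T)) \<longlongrightarrow> 0) at_top"
      by (rule filterlim_compose[OF g(3) filterlim_uminus_at_bot_at_top])
    then show "((\<lambda>T. (b - a) * (g T + g (-T))) \<longlongrightarrow> 0) at_top"
      by (auto intro!: tendsto_eq_intros g(2))
  qed
  ultimately show ?thesis
    using tendsto_unique[of at_top] by force
qed

text \<open>Levy inversion gives a limit of truncated integrals. The kernel \<open>?F\<close> is
  bounded by \<open>b - a\<close>, so an integrable characteristic function makes the whole
  integrand integrable and the limit becomes one Lebesgue integral.\<close>

lemma (in real_distribution) Levy_inversion_integrable:
  fixes a b :: real
  assumes "a \<le> b" "measure M {a} = 0" "measure M {b} = 0" "integrable lborel (char M)"
  shows "complex_of_real (measure M {a<..b}) =
    1 / (2 * pi) * (CLBINT t. (iexp (-(t * a)) - iexp (-(t * b))) / (\<i> * t) * char M t)"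
    (is "_ = _ * (CLBINT t. ?F t * char M t)")
proof -
  \<comment> \<open>At \<open>t = 0\<close> division by zero makes the kernel 0, which respects the
    bound.\<close>
  have F_bound: "cmod (?F t) \<le> b - a" for t
    using Levy_Inversion_aux2[of "-b" "-a" t] \<open>a \<le> b\<close> by (cases "t = 0") auto
  have int: "integrable lborel (\<lambda>t. ?F t * char M t)"
  proof (rule Bochner_Integration.integrable_bound)
    show "integrable lborel (\<lambda>t. (b - a) * norm (char M t))"
      using assms(4) by simp
    show "AE t in lborel. norm (?F t * char M t) \<le> norm ((b - a) * norm (char M t))"
    proof (rule AE_I2)
      fix t
      have "norm (?F t * char M t) \<le> (b - a) * norm (char M t)"
        unfolding norm_mult by (intro mult_right_mono F_bound norm_ge_zero)
      then show "norm (?F t * char M t) \<le> norm ((b - a) * norm (char M t))"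
        by (simp only: real_norm_def)
    qed
  qed (use assms(4) in simp)
  have "(\<lambda>T::nat. 1 / (2 * pi) * (CLBINT t=-real T..real T. ?F t * char M t)) \<longlonglongrightarrow>
      1 / (2 * pi) * (CLBINT t. ?F t * char M t)"
  proof (rule tendsto_mult_left)
    have "(CLBINT t=-real T..real T. ?F t * char M t) = integral {-real T..T} (\<lambda>t. ?F t * char M t)" for T :: nat
      using integrable_mult_indicator[OF _ int]
      by (intro interval_integral_eq_integral) (auto simp: set_integrable_def)
    then show "(\<lambda>T::nat. CLBINT t=-real T..real T. ?F t * char M t) \<longlonglongrightarrow> (CLBINT t. ?F t * char M t)"
      using filterlim_compose[OF integral_real_symmetric_intervals[OF int] filterlim_real_sequentially]
      by simp
  qed
  with Levy_Inversion[OF assms(1-3)] show ?thesis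
    unfolding of_int_minus of_int_of_nat_eq by (rule LIMSEQ_unique)
qed

text \<open>The density at \<open>x\<close> is the limit of the mass of \<open>{x<..x + h}\<close>
  divided by h. In the inversion formula the kernel divided by h has norm at most 1 and tends to
  \<open>iexp (-(t * x))\<close>, so dominated convergence applies with majorant
  \<open>norm (char M t)\<close>.\<close>

lemma (in real_distribution) continuous_density_inversion:
  fixes f :: "real \<Rightarrow> real"
  assumes density: "M = density lborel (\<lambda>x. ennreal (f x))"
    and nonneg: "\<And>x. 0 \<le> f x" and cont: "continuous_on UNIV f"
    and char: "integrable lborel (char M)"
  shows "complex_of_real (f x) = 1 / (2 * pi) * (CLBINT t. iexp (-(t * x)) * char M t)"
proof -
  \<comment> \<open>Positive increments of size at most 1 keep \<open>x + h n\<close> inside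
    \<open>{x..x+1}\<close>, where the one-sided derivative is taken.\<close>
  define h where "h n = 1 / real (Suc n)" for n
  have h: "h n > 0" "h n \<le> 1" for n by (simp_all add: h_def)
  have h_lim: "h \<longlonglongrightarrow> 0"
    unfolding h_def using LIMSEQ_inverse_real_of_nat by (simp add: inverse_eq_divide)
  let ?F = "\<lambda>y t. (iexp (-(t * x)) - iexp (-(t * y))) / (\<i> * t)"
  have [measurable]: "f \<in> borel_measurable borel"
    using cont by (rule borel_measurable_continuous_onI)
  \<comment> \<open>Inversion requires interval endpoints without atoms.\<close>
  have null: "measure M {y} = 0" for y
    by (simp add: density measure_def emeasure_density nn_integral_0_iff_AE
        AE_lborel_singleton[THEN eventually_mono] split: split_indicator)
  have meas: "measure M {x<..y} = integral {x..y} f" if "x \<le> y" for y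
  proof -
    have "measure M {x<..y} = enn2real (\<integral>\<^sup>+s. ennreal (indicator {x..y} s * f s) \<partial>lborel)"
      unfolding density measure_def
      by (subst emeasure_density)
        (auto intro!: arg_cong[where f = enn2real] nn_integral_cong_AE
          eventually_mono[OF AE_lborel_singleton[of x]] split: split_indicator)
    also have "\<dots> = (LBINT s. indicator {x..y} s * f s)"
      using nonneg by (subst integral_eq_nn_integral) auto
    also have "\<dots> = integral {x..y} f"
      using set_borel_integral_eq_integral(2)[OF borel_integrable_atLeastAtMost'[of x y f]]
        continuous_on_subset[OF cont]
      by (simp add: set_lebesgue_integral_def)
    finally show ?thesis .
  qed
  have "((\<lambda>y. integral {x..y} f) has_real_derivative f x) (at x within {x..x+1})"
    using continuous_on_subset[OF cont] by (intro integral_has_real_derivative) auto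
  then have "((\<lambda>y. (integral {x..y} f - integral {x..x} f) / (y - x)) \<longlongrightarrow> f x) (at x within {x..x+1})"
    by (simp add: has_field_derivative_iff)
  moreover have "filterlim (\<lambda>n. x + h n) (at x within {x..x+1}) sequentially"
    unfolding filterlim_at
  proof (intro conjI always_eventually allI)
    show "(\<lambda>n. x + h n) \<longlonglongrightarrow> x" using tendsto_add[OF tendsto_const h_lim, of x] by simp
    show "x + h n \<in> {x..x + 1}" "x + h n \<noteq> x" for n using h[of n] by auto
  qed
  ultimately have "(\<lambda>n. (integral {x..x + h n} f - integral {x..x} f) / (x + h n - x)) \<longlonglongrightarrow> f x"
    by (rule filterlim_compose)
  then have "(\<lambda>n. complex_of_real (measure M {x<..x + h n} / h n)) \<longlonglongrightarrow> complex_of_real (f x)"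
    using meas h by (intro tendsto_of_real) (simp add: less_imp_le)
  moreover have "complex_of_real (measure M {x<..x + h n} / h n) =
      1 / (2 * pi) * (CLBINT t. ?F (x + h n) t / h n * char M t)" for n
  proof -
    have "(CLBINT t. ?F (x + h n) t / h n * char M t) = (CLBINT t. ?F (x + h n) t * char M t) / h n"
      by (simp only: times_divide_eq_left integral_divide_zero)
    then show ?thesis
      using Levy_inversion_integrable[of x "x + h n"] h[of n] null char
      by (simp only: of_real_divide times_divide_eq_right)
  qed
  moreover have "(\<lambda>n. 1 / (2 * pi) * (CLBINT t. ?F (x + h n) t / h n * char M t)) \<longlonglongrightarrow>
      1 / (2 * pi) * (CLBINT t. iexp (-(t * x)) * char M t)"
  proof (intro tendsto_mult_left integral_dominated_convergence[where w = "\<lambda>t. norm (char M t)"])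
    show "AE t in lborel. norm (?F (x + h n) t / h n * char M t) \<le> norm (char M t)" for n
    proof (rule AE_I2)
      fix t
      have "cmod (?F (x + h n) t) \<le> h n"
      proof (cases "t = 0")
        case False
        have "- (x + h n) \<le> - x" using h(1)[of n] by simp
        from Levy_Inversion_aux2[OF this False] show ?thesis
          by (simp only: mult_minus_right)
      qed (use h(1)[of n] in simp)
      then have "cmod (?F (x + h n) t / h n) \<le> 1"
        using h(1)[of n]
        by (simp only: norm_divide[of _ "complex_of_real (h n)"] norm_of_real abs_of_pos
            divide_le_eq_1_pos)
      then show "norm (?F (x + h n) t / h n * char M t) \<le> norm (char M t)"
        unfolding norm_mult by (intro mult_left_le_one_le) auto
    qed
    \<comment> \<open>Up to the factor -1/(it) this is the difference quotient of z \<mapsto>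
      exp(-itz) at \<open>x\<close>. The excluded point \<open>t = 0\<close> is a null set.\<close>
    have "(\<lambda>n. ?F (x + h n) t / h n) \<longlonglongrightarrow> iexp (-(t * x))" if "t \<noteq> 0" for t
    proof -
      have "((\<lambda>z. exp (\<i> * (-(t * z)))) has_field_derivative - (\<i> * t) * iexp (-(t * x)))
          (at (complex_of_real x))"
        by (auto intro!: derivative_eq_intros)
      then have "((\<lambda>z. (exp (\<i> * (-(t * z))) - iexp (-(t * x))) / (z - complex_of_real x))
          \<longlongrightarrow> - (\<i> * t) * iexp (-(t * x))) (at (complex_of_real x))"
        by (simp add: has_field_derivative_iff)
      moreover have "filterlim (\<lambda>n. complex_of_real (x + h n)) (at (complex_of_real x)) sequentially"
        unfolding filterlim_at
      proof (intro conjI always_eventually allI)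
        show "(\<lambda>n. complex_of_real (x + h n)) \<longlonglongrightarrow> x"
          using tendsto_add[OF tendsto_const h_lim, of x] by (intro tendsto_of_real) simp
        show "complex_of_real (x + h n) \<in> UNIV" "complex_of_real (x + h n) \<noteq> x" for n
          using h(1)[of n] by auto
      qed
      ultimately have "(\<lambda>n. (iexp (-(t * (x + h n))) - iexp (-(t * x))) / h n)
          \<longlonglongrightarrow> - (\<i> * t) * iexp (-(t * x))"
        using filterlim_compose by fastforce
      from tendsto_mult_left[OF this, of "- 1 / (\<i> * t)"]
      have "(\<lambda>n. - 1 / (\<i> * t) * ((iexp (-(t * (x + h n))) - iexp (-(t * x))) / h n))
          \<longlonglongrightarrow> iexp (-(t * x))"
        using that by simp
      moreover have "- 1 / (\<i> * t) * ((v - u) / h n) = (u - v) / (\<i> * t) / h n" for u v :: complex and n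
        by (simp add: diff_divide_distrib mult_ac)
      ultimately show ?thesis by (simp only:)
    qed
    then show "AE t in lborel. (\<lambda>n. ?F (x + h n) t / h n * char M t) \<longlonglongrightarrow> iexp (-(t * x)) * char M t"
      by (intro eventually_mono[OF AE_lborel_singleton[of 0]] tendsto_mult_right)
  qed (use char in simp_all)
  ultimately show ?thesis
    using LIMSEQ_unique by simp
qed

section \<open>Gaussian integral and second-order remainder estimates\<close>

lemma gaussian_integral:
  fixes c :: real
  assumes "c > 0"
  shows "has_bochner_integral lborel (\<lambda>x. exp (- (c * x\<^sup>2))) (sqrt (pi / c))"
proof -
  \<comment> \<open>The standard deviation for which the exponent of the normal density is
    \<open>- (c * x\<^sup>2)\<close>.\<close>
  let ?s = "1 / sqrt (2 * c)"
  have "has_bochner_integral lborel (normal_density 0 ?s) 1"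
    using assms by (simp add: has_bochner_integral_iff)
  from has_bochner_integral_mult_right[OF this, of "sqrt (pi / c)"]
  show ?thesis
    using assms by (simp add: normal_density_def power_divide real_sqrt_mult real_sqrt_divide field_simps)
qed

lemma norm_exp_minus_one_minus_le:
  fixes z :: complex
  shows "norm (exp z - 1 - z) \<le> exp \<bar>Re z\<bar> * (norm z)\<^sup>2"
  using Taylor_exp[of z 1] by (simp add: power2_eq_square algebra_simps)

text \<open>Allows differentiation under the integral sign by one uniform second-order estimate,
  with no limit taken inside the integral.\<close>

lemma has_field_derivative_quadratic_remainder:
  fixes f :: "'a::real_normed_field \<Rightarrow> 'a"
  assumes "\<delta> > 0"
    and bound: "\<And>h. norm h \<le> \<delta> \<Longrightarrow> norm (f (z + h) - f z - h * D) \<le> C * (norm h)\<^sup>2"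
  shows "(f has_field_derivative D) (at z)"
  unfolding DERIV_def
proof (rule LIM_zero_cancel, rule Lim_null_comparison)
  show "\<forall>\<^sub>F h in at 0. norm ((f (z + h) - f z) / h - D) \<le> C * norm h"
  proof (rule eventually_at[THEN iffD2], intro exI conjI ballI impI)
    fix h :: 'a assume h: "h \<noteq> 0 \<and> dist h 0 < \<delta>"
    have "norm ((f (z + h) - f z) / h - D) = norm (f (z + h) - f z - h * D) / norm h"
      using h by (simp add: diff_divide_distrib flip: norm_divide)
    also have "\<dots> \<le> C * (norm h)\<^sup>2 / norm h"
      using h by (intro divide_right_mono bound) auto
    finally show "norm ((f (z + h) - f z) / h - D) \<le> C * norm h"
      using h by (simp add: power2_eq_square)
  qed (fact assms(1))
  show "((\<lambda>h. C * norm h) \<longlongrightarrow> 0) (at 0)"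
    by (auto intro!: tendsto_eq_intros)
qed

subsection \<open>The exponent of a spectrally negative measure\<close>

locale spectrally_negative_levy_measure =
  fixes \<nu> :: "real measure"
  assumes levy: "levy_measure \<nu>"
    and no_positive_jumps: "emeasure \<nu> {0<..} = 0"
begin

lemma sets_nu [measurable_cong]: "sets \<nu> = sets borel"
  using levy by (simp add: levy_measure_def)

lemma space_nu [simp]: "space \<nu> = UNIV"
  using sets_eq_imp_space_eq[OF sets_nu] by simp

sublocale sigma_finite_measure \<nu>
  using levy by (simp add: levy_measure_def)

lemma AE_negative: "AE r in \<nu>. r < 0"
proof -
  have "AE r in \<nu>. r \<notin> {0}" "AE r in \<nu>. r \<notin> {0<..}"
    using levy no_positive_jumps by (intro AE_not_in; simp add: null_sets_def levy_measure_def)+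
  then show ?thesis by eventually_elim auto
qed

lemma integrable_min_one_square: "integrable \<nu> (\<lambda>r. min 1 (r\<^sup>2))"
  using levy by (intro integrableI_nonneg) (auto simp: levy_measure_def)

text \<open>The measure is carried by the negative half-line, so domination has to be checked for
  \<open>r < 0\<close> only.\<close>

lemma integrable_bounded_by_min_one_square:
  fixes f :: "real \<Rightarrow> 'a::{banach, second_countable_topology}"
  assumes [measurable]: "f \<in> borel_measurable borel"
    and "\<And>r. r < 0 \<Longrightarrow> norm (f r) \<le> C * min 1 (r\<^sup>2)"
  shows "integrable \<nu> f"
proof (rule Bochner_Integration.integrable_bound)
  show "integrable \<nu> (\<lambda>r. C * min 1 (r\<^sup>2))"
    using integrable_min_one_square by simp
  show "AE r in \<nu>. norm (f r) \<le> norm (C * min 1 (r\<^sup>2))"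
    using AE_negative by eventually_elim (use assms(2) in \<open>force intro: order_trans\<close>)
qed simp

section \<open>Integrability and continuity of the jump part of the exponent\<close>

definition jump_kernel :: "complex \<Rightarrow> real \<Rightarrow> complex" where
  "jump_kernel u r = exp (u * of_real r) - 1 - u * of_real r * indicator {-1..1} r"

definition jump_exponent :: "complex \<Rightarrow> complex" where
  "jump_exponent u = (LINT r|\<nu>. jump_kernel u r)"

lemma borel_measurable_jump_kernel [measurable]: "jump_kernel u \<in> borel_measurable borel"
  unfolding jump_kernel_def by measurable

text \<open>For \<open>-1 \<le> r\<close> the second-order Taylor remainder of exp gives a multiple
  of \<open>r\<^sup>2\<close>. For \<open>r < -1\<close> the compensator is absent and
  \<open>exp (Re u * r) \<le> 1\<close>, so the kernel has norm at most 2. The constant is the sum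
  of the two.\<close>

lemma norm_jump_kernel_le:
  assumes "Re u \<ge> 0" "r < 0"
  shows "norm (jump_kernel u r) \<le> (2 + exp (Re u) * (norm u)\<^sup>2) * min 1 (r\<^sup>2)"
proof (cases "-1 \<le> r")
  case True
  then have r2: "r\<^sup>2 \<le> 1"
    using \<open>r < 0\<close> by (simp add: abs_square_le_1)
  have "norm (jump_kernel u r) \<le> exp \<bar>Re u * r\<bar> * (norm (u * of_real r))\<^sup>2"
    using norm_exp_minus_one_minus_le[of "u * of_real r"] True \<open>r < 0\<close> by (simp add: jump_kernel_def)
  also have "\<dots> \<le> exp (Re u) * (norm (u * of_real r))\<^sup>2"
    using assms True mult_left_le[of "-r" "Re u"]
    by (intro mult_right_mono) (auto simp: abs_mult)
  also have "\<dots> = exp (Re u) * (norm u)\<^sup>2 * r\<^sup>2"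
    by (simp add: norm_mult power_mult_distrib)
  also have "\<dots> \<le> (2 + exp (Re u) * (norm u)\<^sup>2) * r\<^sup>2"
    by (intro mult_right_mono) auto
  finally show ?thesis using r2 by simp
next
  case False
  have "norm (jump_kernel u r) \<le> exp (Re u * r) + 1"
    using False norm_triangle_ineq4[of "exp (u * of_real r)" 1] by (simp add: jump_kernel_def)
  also have "\<dots> \<le> 2"
    using assms by (simp add: mult_nonneg_nonpos)
  finally have "norm (jump_kernel u r) \<le> 2" .
  moreover have "r\<^sup>2 \<ge> 1"
    using False by (simp add: abs_square_le_1 flip: not_less) (simp add: abs_square_less_1)
  ultimately show ?thesis by (simp add: add_increasing2)
qed

lemma integrable_jump_kernel: "Re u \<ge> 0 \<Longrightarrow> integrable \<nu> (jump_kernel u)"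
  by (rule integrable_bounded_by_min_one_square) (auto intro: norm_jump_kernel_le)

text \<open>Continuity is proved up to the boundary \<open>Re u = 0\<close>, where the kernel of the
  derivative need not be integrable.\<close>

lemma continuous_on_jump_exponent: "continuous_on {u. Re u \<ge> 0} jump_exponent"
  unfolding continuous_on_sequentially comp_def
proof (intro ballI allI impI, elim conjE)
  fix U u assume u: "u \<in> {u. Re u \<ge> 0}" and U: "\<forall>n. U n \<in> {u. Re u \<ge> 0}" "U \<longlonglongrightarrow> u"
  \<comment> \<open>A convergent sequence is bounded, so one multiple of
    \<open>min 1 (r\<^sup>2)\<close> dominates all the kernels along it.\<close>
  obtain B where B: "\<And>n. norm (U n) \<le> B"
    using convergent_imp_Bseq[of U] U(2) unfolding convergent_def Bseq_def by blast
  have jump_kernel_bound: "norm (jump_kernel (U n) r) \<le> (2 + exp B * B\<^sup>2) * min 1 (r\<^sup>2)"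
    if "r < 0" for n r
  proof -
    have "norm (jump_kernel (U n) r) \<le> (2 + exp (Re (U n)) * (norm (U n))\<^sup>2) * min 1 (r\<^sup>2)"
      using U that by (intro norm_jump_kernel_le) auto
    also have "\<dots> \<le> (2 + exp B * B\<^sup>2) * min 1 (r\<^sup>2)"
      using B[of n] order_trans[OF complex_Re_le_cmod B[of n]]
      by (intro mult_right_mono add_left_mono mult_mono power_mono) auto
    finally show ?thesis .
  qed
  show "(\<lambda>n. jump_exponent (U n)) \<longlonglongrightarrow> jump_exponent u"
    unfolding jump_exponent_def
  proof (rule integral_dominated_convergence)
    show "integrable \<nu> (\<lambda>r. (2 + exp B * B\<^sup>2) * min 1 (r\<^sup>2))"
      using integrable_min_one_square by simp
    show "AE r in \<nu>. (\<lambda>n. jump_kernel (U n) r) \<longlonglongrightarrow> jump_kernel u r"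
      unfolding jump_kernel_def by (intro AE_I2 tendsto_intros U)
    show "AE r in \<nu>. norm (jump_kernel (U n) r) \<le> (2 + exp B * B\<^sup>2) * min 1 (r\<^sup>2)" for n
      using AE_negative by eventually_elim (rule jump_kernel_bound)
  qed measurable
qed

text \<open>With z = -cr the inequality z^2/2 \<le> exp z bounds the left side by
  \<open>2 / c\<^sup>2\<close>, and \<open>exp (c * r) \<le> 1\<close> bounds it by
  \<open>r\<^sup>2\<close>. The two bounds combine into a multiple of the minimum.\<close>

lemma square_exp_le:
  fixes c r :: real
  assumes "c > 0" "r < 0"
  shows "r\<^sup>2 * exp (c * r) \<le> (1 + 2 / c\<^sup>2) * min 1 (r\<^sup>2)"
proof -
  let ?A = "r\<^sup>2 * exp (c * r)"
  have "0 \<le> - (c * r)"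
    using assms by (simp add: mult_le_0_iff)
  from exp_lower_Taylor_quadratic[OF this] this have "(c * r)\<^sup>2 / 2 \<le> exp (- (c * r))"
    by simp
  then have "(c * r)\<^sup>2 / 2 * exp (c * r) \<le> exp (- (c * r)) * exp (c * r)"
    by (intro mult_right_mono) auto
  then have "?A \<le> 2 / c\<^sup>2"
    using assms(1) by (simp add: field_simps power_mult_distrib flip: exp_add)
  moreover have "?A \<le> r\<^sup>2"
    using assms by (intro mult_left_le) (auto simp: mult_le_0_iff)
  moreover have "A \<le> (1 + C) * min 1 s" if "A \<le> C" "A \<le> s" "0 \<le> C" "0 \<le> s" for A C s :: real
    using that by (auto simp: min_def distrib_right intro: add_increasing2)
  ultimately show ?thesis by simp
qed

lemma integrable_square_exp: "c > 0 \<Longrightarrow> integrable \<nu> (\<lambda>r. r\<^sup>2 * exp (c * r))"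
  by (rule integrable_bounded_by_min_one_square[where C = "1 + 2 / c\<^sup>2"])
    (auto simp: square_exp_le)

section \<open>Complex differentiability of the jump part in the open right half-plane\<close>

definition jump_kernel' :: "complex \<Rightarrow> real \<Rightarrow> complex" where
  "jump_kernel' u r = of_real r * exp (u * of_real r) - of_real r * indicator {-1..1} r"

definition jump_exponent' :: "complex \<Rightarrow> complex" where
  "jump_exponent' u = (LINT r|\<nu>. jump_kernel' u r)"

text \<open>For \<open>-1 \<le> r\<close> a first-order Taylor bound supplies a second factor r. For
  \<open>r < -1\<close> one has \<bar>r\<bar> \<le> \<open>r\<^sup>2\<close>, and the decay of
  \<open>exp (Re u * r)\<close>, available because \<open>Re u > 0\<close>, does the rest.\<close>

lemma integrable_jump_kernel':
  assumes "Re u > 0"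
  shows "integrable \<nu> (jump_kernel' u)"
proof -
  let ?C = "1 + 2 / (Re u)\<^sup>2 + exp (Re u) * norm u"
  show ?thesis
  proof (rule integrable_bounded_by_min_one_square)
    show "jump_kernel' u \<in> borel_measurable borel" unfolding jump_kernel'_def by measurable
    show "norm (jump_kernel' u r) \<le> ?C * min 1 (r\<^sup>2)" if "r < 0" for r
    proof (cases "-1 \<le> r")
      case True
      then have r2: "r\<^sup>2 \<le> 1"
        using \<open>r < 0\<close> by (simp add: abs_square_le_1)
      have "norm (jump_kernel' u r) = norm (of_real r * (exp (u * of_real r) - 1))"
        using True \<open>r < 0\<close> by (simp add: jump_kernel'_def algebra_simps)
      also have "\<dots> \<le> \<bar>r\<bar> * (exp \<bar>Re u * r\<bar> * norm (u * of_real r))"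
        unfolding norm_mult using Taylor_exp[of "u * of_real r" 0] by (intro mult_mono) (auto simp: norm_mult)
      also have "\<dots> \<le> \<bar>r\<bar> * (exp (Re u) * norm (u * of_real r))"
        using assms True \<open>r < 0\<close> mult_left_le[of "-r" "Re u"]
        by (intro mult_left_mono mult_right_mono) (auto simp: abs_mult)
      also have "\<dots> = exp (Re u) * norm u * r\<^sup>2"
        by (simp add: norm_mult power2_eq_square)
      also have "\<dots> \<le> ?C * r\<^sup>2"
        by (intro mult_right_mono) auto
      finally show ?thesis using r2 by simp
    next
      case False
      have "norm (jump_kernel' u r) = \<bar>r\<bar> * exp (Re u * r)"
        using False by (simp add: jump_kernel'_def norm_mult)
      also have "\<dots> \<le> r\<^sup>2 * exp (Re u * r)"
        using False mult_left_mono[of 1 "-r" "-r"]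
        by (intro mult_right_mono) (auto simp: power2_eq_square abs_if)
      also have "\<dots> \<le> (1 + 2 / (Re u)\<^sup>2) * min 1 (r\<^sup>2)"
        using assms \<open>r < 0\<close> by (rule square_exp_le)
      also have "\<dots> \<le> ?C * min 1 (r\<^sup>2)"
        by (intro mult_right_mono) auto
      finally show ?thesis .
    qed
  qed
qed

text \<open>The truncation terms cancel in the remainder of the kernel, which factors as exp(ur)
  (exp(hr) - 1 - hr) and is thus of second order in h.\<close>

lemma jump_exponent_has_field_derivative:
  assumes "Re u > 0"
  shows "(jump_exponent has_field_derivative jump_exponent' u) (at u)"
proof (rule has_field_derivative_quadratic_remainder)
  \<comment> \<open>Increments of at most half the distance to the imaginary axis cost at most half
    of the decay of \<open>exp (Re u * r)\<close>; the other half keeps the majorant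
    \<open>r\<^sup>2 * exp (?c * r)\<close> integrable.\<close>
  let ?c = "Re u / 2"
  show "?c > 0" using assms by simp
  fix h :: complex assume h: "norm h \<le> ?c"
  then have "Re (u + h) \<ge> 0"
    using abs_Re_le_cmod[of h] assms by simp
  then have int: "integrable \<nu> (jump_kernel (u + h))" "integrable \<nu> (jump_kernel u)"
    "integrable \<nu> (jump_kernel' u)"
    using assms by (auto intro: integrable_jump_kernel integrable_jump_kernel')
  have "norm (jump_exponent (u + h) - jump_exponent u - h * jump_exponent' u) =
      norm (LINT r|\<nu>. jump_kernel (u + h) r - jump_kernel u r - h * jump_kernel' u r)"
    using int by (simp add: jump_exponent_def jump_exponent'_def)
  also have "\<dots> \<le> (LINT r|\<nu>. (norm h)\<^sup>2 * (r\<^sup>2 * exp (?c * r)))"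
  proof (rule order_trans[OF integral_norm_bound integral_mono_AE'])
    show "integrable \<nu> (\<lambda>r. (norm h)\<^sup>2 * (r\<^sup>2 * exp (?c * r)))"
      using assms by (intro integrable_mult_right integrable_square_exp) simp
    show "AE r in \<nu>. norm (jump_kernel (u + h) r - jump_kernel u r - h * jump_kernel' u r)
        \<le> (norm h)\<^sup>2 * (r\<^sup>2 * exp (?c * r))"
      using AE_negative
    proof eventually_elim
      case (elim r)
      have "\<bar>Re h * r\<bar> \<le> ?c * (- r)"
        using order_trans[OF abs_Re_le_cmod h] elim unfolding abs_mult by (intro mult_mono) auto
      then have exp_le: "exp (Re u * r) * exp \<bar>Re h * r\<bar> \<le> exp (?c * r)"
        by (simp add: algebra_simps flip: exp_add)
      have "jump_kernel (u + h) r - jump_kernel u r - h * jump_kernel' u r =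
          exp (u * of_real r) * (exp (h * of_real r) - 1 - h * of_real r)"
        by (simp add: jump_kernel_def jump_kernel'_def algebra_simps exp_add)
      also have "norm \<dots> \<le> exp (Re u * r) * (exp \<bar>Re h * r\<bar> * (norm (h * of_real r))\<^sup>2)"
        unfolding norm_mult[of "exp _"] using norm_exp_minus_one_minus_le[of "h * of_real r"]
        by (intro mult_mono) auto
      also have "\<dots> = (norm h)\<^sup>2 * (r\<^sup>2 * (exp (Re u * r) * exp \<bar>Re h * r\<bar>))"
        by (simp add: norm_mult power_mult_distrib)
      also have "\<dots> \<le> (norm h)\<^sup>2 * (r\<^sup>2 * exp (?c * r))"
        using exp_le by (intro mult_left_mono) auto
      finally show ?case .
    qed
  qed auto
  finally show "norm (jump_exponent (u + h) - jump_exponent u - h * jump_exponent' u)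
      \<le> (LINT r|\<nu>. r\<^sup>2 * exp (?c * r)) * (norm h)\<^sup>2"
    by (simp add: mult.commute)
qed


section \<open>Real and complex forms of the exponent and their derivatives\<close>

lemma levy_exponent_complex:
  "levy_exponent b \<sigma> \<nu> u = of_real b * u + of_real (\<sigma>\<^sup>2) / 2 * u\<^sup>2 + jump_exponent u"
  by (simp add: levy_exponent_def jump_exponent_def jump_kernel_def)

lemma jump_kernel_of_real:
  "jump_kernel (of_real x) r = of_real (exp (x * r) - 1 - x * r * indicator {-1..1} r)"
  by (simp add: jump_kernel_def indicator_def flip: exp_of_real)

lemma of_real_levy_exponent:
  "complex_of_real (levy_exponent b \<sigma> \<nu> x) = levy_exponent b \<sigma> \<nu> (complex_of_real x)"
  unfolding levy_exponent_complex jump_exponent_def jump_kernel_of_real integral_complex_of_real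
  by (simp add: levy_exponent_def)

lemma levy_exponent_has_field_derivative:
  assumes "Re u > 0"
  shows "(levy_exponent b \<sigma> \<nu> has_field_derivative
    of_real b + of_real (\<sigma>\<^sup>2) * u + jump_exponent' u) (at u)"
  unfolding levy_exponent_complex[abs_def]
  by (auto intro!: derivative_eq_intros jump_exponent_has_field_derivative assms)

text \<open>The complex exponent is differentiated along the real axis. Its values there are real,
  so the imaginary part of the derivative is that of a constant function and vanishes, while the
  real part is the derivative of the real exponent.\<close>

lemma of_real_deriv_levy_exponent:
  assumes "x > 0"
  shows "complex_of_real (deriv (levy_exponent b \<sigma> \<nu>) x) =
    of_real b + of_real (\<sigma>\<^sup>2) * of_real x + jump_exponent' (of_real x)" (is "_ = ?D")
proof -
  have "((\<lambda>x. levy_exponent b \<sigma> \<nu> (complex_of_real x)) has_vector_derivative ?D) (at x)"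
    using assms by (intro has_vector_derivative_real_field levy_exponent_has_field_derivative) simp
  then have "((\<lambda>x. complex_of_real (levy_exponent b \<sigma> \<nu> x)) has_vector_derivative ?D) (at x)"
    by (simp only: of_real_levy_exponent)
  then have Re: "(levy_exponent b \<sigma> \<nu> has_real_derivative Re ?D) (at x)"
    and "((\<lambda>x. 0) has_real_derivative Im ?D) (at x)"
    by (simp_all only: has_vector_derivative_complex_iff Re_complex_of_real Im_complex_of_real)
  then have "Im ?D = 0"
    using DERIV_unique DERIV_const by blast
  with DERIV_imp_deriv[OF Re] show ?thesis
    by (intro complex_eqI) simp_all
qed

lemma continuous_on_levy_exponent:
  "continuous_on {u. Re u \<ge> 0} (levy_exponent b \<sigma> \<nu> :: complex \<Rightarrow> complex)"
  unfolding levy_exponent_complex[abs_def] by (intro continuous_intros continuous_on_jump_exponent)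

text \<open>Since cos \<le> 1, the real part of the kernel at \<open>u\<close> is at most its value
  at the real point \<open>Re u\<close>; this makes the bound uniform along vertical lines.\<close>

lemma Re_jump_exponent_le:
  assumes "Re u \<ge> 0"
  shows "Re (jump_exponent u) \<le> (2 + exp (Re u) * (Re u)\<^sup>2) * (LINT r|\<nu>. min 1 (r\<^sup>2))"
proof -
  have "Re (jump_exponent u) = (LINT r|\<nu>. Re (jump_kernel u r))"
    unfolding jump_exponent_def using integrable_jump_kernel[OF assms] by (rule integral_Re[symmetric])
  also have "\<dots> \<le> (LINT r|\<nu>. (2 + exp (Re u) * (Re u)\<^sup>2) * min 1 (r\<^sup>2))"
  proof (rule integral_mono_AE)
    show "integrable \<nu> (\<lambda>r. (2 + exp (Re u) * (Re u)\<^sup>2) * min 1 (r\<^sup>2))"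
      using integrable_min_one_square by simp
    show "AE r in \<nu>. Re (jump_kernel u r) \<le> (2 + exp (Re u) * (Re u)\<^sup>2) * min 1 (r\<^sup>2)"
      using AE_negative
    proof eventually_elim
      case (elim r)
      have "exp (Re u * r) * cos (Im u * r) \<le> exp (Re u * r)"
        by (intro mult_left_le) auto
      then have "Re (jump_kernel u r) \<le> Re (jump_kernel (of_real (Re u)) r)"
        by (simp add: jump_kernel_def Re_exp indicator_def)
      also have "\<dots> \<le> norm (jump_kernel (of_real (Re u)) r)"
        by (rule complex_Re_le_cmod)
      also have "\<dots> \<le> (2 + exp (Re u) * (Re u)\<^sup>2) * min 1 (r\<^sup>2)"
        using norm_jump_kernel_le[of "of_real (Re u)" r] assms elim by simp
      finally show ?case .
    qed
  qed (use integrable_jump_kernel[OF assms] in auto)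
  finally show ?thesis by simp
qed

text \<open>The real part of u^2 contains \<open>- (Im u)\<^sup>2\<close>, which yields the Gaussian
  decay; all other contributions are bounded above on the strip. The constant is obtained before
  \<open>u\<close>, hence is uniform there.\<close>

lemma exp_levy_exponent_gaussian_bound:
  assumes "t \<ge> 0" "y \<ge> 0"
  obtains C where "\<And>u. 0 \<le> Re u \<Longrightarrow> Re u \<le> y \<Longrightarrow>
    norm (exp (of_real t * levy_exponent b \<sigma> \<nu> u - u * of_real x))
      \<le> C * exp (- (t * \<sigma>\<^sup>2 / 2 * (Im u)\<^sup>2))"
proof
  fix u :: complex assume u: "0 \<le> Re u" "Re u \<le> y"
  let ?m = "LINT r|\<nu>. min 1 (r\<^sup>2)"
  let ?B = "\<bar>b\<bar> * y + \<sigma>\<^sup>2 / 2 * y\<^sup>2 + (2 + exp y * y\<^sup>2) * ?m"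
  have "b * Re u \<le> \<bar>b\<bar> * y"
    using u abs_ge_self[of b] by (intro mult_mono) auto
  moreover have "\<sigma>\<^sup>2 / 2 * (Re u)\<^sup>2 \<le> \<sigma>\<^sup>2 / 2 * y\<^sup>2"
    using u by (intro mult_left_mono power_mono) auto
  moreover have "Re (jump_exponent u) \<le> (2 + exp y * y\<^sup>2) * ?m"
    using u by (intro order_trans[OF Re_jump_exponent_le] mult_right_mono add_left_mono
          mult_mono power_mono) auto
  moreover have "Re (levy_exponent b \<sigma> \<nu> u) =
      b * Re u + \<sigma>\<^sup>2 / 2 * (Re u)\<^sup>2 + Re (jump_exponent u) - \<sigma>\<^sup>2 / 2 * (Im u)\<^sup>2"
    by (simp add: levy_exponent_complex Re_power2 right_diff_distrib)
  ultimately have "Re (levy_exponent b \<sigma> \<nu> u) \<le> ?B - \<sigma>\<^sup>2 / 2 * (Im u)\<^sup>2"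
    by linarith
  then have "t * Re (levy_exponent b \<sigma> \<nu> u) \<le> t * ?B - t * \<sigma>\<^sup>2 / 2 * (Im u)\<^sup>2"
    using mult_left_mono[OF _ \<open>t \<ge> 0\<close>] by (fastforce simp: right_diff_distrib mult_ac)
  moreover have "- (Re u * x) \<le> y * \<bar>x\<bar>"
    using mult_left_mono[OF abs_ge_minus_self u(1), of x] mult_right_mono[OF u(2) abs_ge_zero, of x]
    by simp
  ultimately show "norm (exp (of_real t * levy_exponent b \<sigma> \<nu> u - u * of_real x)) \<le>
      exp (t * ?B + y * \<bar>x\<bar>) * exp (- (t * \<sigma>\<^sup>2 / 2 * (Im u)\<^sup>2))"
    by (simp flip: exp_add)
qed

text \<open>Tonelli: the tail \<open>measure \<nu> {..<r}\<close> is the integral of the indicator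
  of \<open>q < r\<close>, and after the exchange the integral over r in (q, 0) is elementary. The
  right-hand side is the jump part of the Legendre-type expression \<Psi>(y) - y\<Psi>'(y).\<close>

lemma jump_tail_identity:
  assumes "y > 0"
  shows "y\<^sup>2 * (LBINT r:{..<0}. exp (y * r) * r * measure \<nu> {..<r}) =
    (LINT q|\<nu>. exp (y * q) - 1 - y * q * exp (y * q))"
proof -
  interpret P: pair_sigma_finite \<nu> lborel ..
  \<comment> \<open>The sign is reversed so that the integrand is nonnegative on the negative
    half-line and the exchange takes place between nonnegative integrals.\<close>
  define g where "g r = - r * exp (y * r)" for r :: real
  have [measurable]: "g \<in> borel_measurable borel" unfolding g_def by measurable
  have g_nonneg: "g r \<ge> 0" if "r \<le> 0" for r
    using that by (simp add: g_def mult_le_0_iff)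
  \<comment> \<open>\<open>measure\<close> would return 0 on a set of infinite mass, so finiteness
    is what makes it the true tail.\<close>
  have tail_finite: "emeasure \<nu> {..<r} < \<infinity>" if "r < 0" for r
  proof -
    have "integrable \<nu> (indicat_real {..<r})"
    proof (rule integrable_bounded_by_min_one_square)
      show "norm (indicat_real {..<r} q) \<le> 1 / min 1 (r\<^sup>2) * min 1 (q\<^sup>2)" for q
      proof -
        have "r\<^sup>2 \<le> q\<^sup>2" if "q < r"
          using power_mono[of "-r" "-q" 2] that \<open>r < 0\<close> by simp
        then show ?thesis
          using \<open>r < 0\<close> by (auto split: split_indicator simp: min_def field_simps)
      qed
    qed simp
    then show ?thesis by (simp add: integrable_indicator_iff sets_nu less_top)
  qed
  have inner: "(\<integral>\<^sup>+r. ennreal (g r) * indicator {q<..<0} r \<partial>lborel) =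
      ennreal ((1 - exp (y * q) + y * q * exp (y * q)) / y\<^sup>2)" if "q < 0" for q
  proof -
    \<comment> \<open>The antiderivative of \<open>g\<close>, found by parts.\<close>
    let ?G = "\<lambda>r. exp (y * r) * (1 / y\<^sup>2 - r / y)"
    have "(\<integral>\<^sup>+r. ennreal (g r) * indicator {q<..<0} r \<partial>lborel) =
        (\<integral>\<^sup>+r. ennreal (g r) * indicator {q..0} r \<partial>lborel)"
      using AE_lborel_singleton[of q] AE_lborel_singleton[of 0]
      by (intro nn_integral_cong_AE, eventually_elim) (auto split: split_indicator)
    also have "\<dots> = ennreal (?G 0 - ?G q)"
    proof (rule nn_integral_FTC_Icc)
      show "(?G has_real_derivative g r) (at r)" for r
        unfolding g_def
        using assms by (auto intro!: derivative_eq_intros simp: field_simps power2_eq_square)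
    qed (use that g_nonneg in auto)
    also have "?G 0 - ?G q = (1 - exp (y * q) + y * q * exp (y * q)) / y\<^sup>2"
      using assms by (simp add: field_simps power2_eq_square)
    finally show ?thesis .
  qed
  have tail_eq: "(\<integral>\<^sup>+q. ennreal (g r) * indicator {q<..<0} r \<partial>\<nu>) =
      ennreal (indicator {..<0} r * (g r * measure \<nu> {..<r}))" for r
  proof (cases "r < 0")
    case True
    have "(\<integral>\<^sup>+q. ennreal (g r) * indicator {q<..<0} r \<partial>\<nu>) =
        (\<integral>\<^sup>+q. ennreal (g r) * indicator {..<r} q \<partial>\<nu>)"
      using True by (intro nn_integral_cong) (auto split: split_indicator)
    also have "\<dots> = ennreal (g r) * emeasure \<nu> {..<r}"
      by (simp add: nn_integral_cmult_indicator sets_nu)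
    also have "\<dots> = ennreal (g r * measure \<nu> {..<r})"
      using tail_finite[OF True] g_nonneg[of r] True
      by (simp add: emeasure_eq_ennreal_measure less_top[symmetric] ennreal_mult')
    finally show ?thesis using True by simp
  qed simp
  have meas: "(\<lambda>(q, r). ennreal (g r) * indicator {q<..<0} r) \<in> borel_measurable (\<nu> \<Otimes>\<^sub>M lborel)"
    unfolding greaterThanLessThan_iff indicator_def by measurable
  have "(LBINT r:{..<0}. exp (y * r) * r * measure \<nu> {..<r}) =
      - (LBINT r. indicator {..<0} r * (g r * measure \<nu> {..<r}))"
    by (simp add: set_lebesgue_integral_def g_def mult_ac flip: Bochner_Integration.integral_minus)
  also have "(LBINT r. indicator {..<0} r * (g r * measure \<nu> {..<r})) =
      enn2real (\<integral>\<^sup>+r. (\<integral>\<^sup>+q. ennreal (g r) * indicator {q<..<0} r \<partial>\<nu>) \<partial>lborel)"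
    unfolding tail_eq
  proof (rule integral_eq_nn_integral)
    \<comment> \<open>Measurability of the tail in r comes from its form as an inner integral of a
      jointly measurable function.\<close>
    have "(\<lambda>r. enn2real (\<integral>\<^sup>+q. ennreal (g r) * indicator {q<..<0} r \<partial>\<nu>)) \<in> borel_measurable lborel"
      using meas by measurable
    then show "(\<lambda>r. indicator {..<0} r * (g r * measure \<nu> {..<r})) \<in> borel_measurable lborel"
      unfolding tail_eq using g_nonneg
      by (subst (asm) enn2real_ennreal) (auto split: split_indicator)
  qed (use g_nonneg in \<open>auto split: split_indicator\<close>)
  also have "\<dots> = enn2real (\<integral>\<^sup>+q. (\<integral>\<^sup>+r. ennreal (g r) * indicator {q<..<0} r \<partial>lborel) \<partial>\<nu>)"
    using P.Fubini[OF meas] by simp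
  also have "\<dots> = enn2real (\<integral>\<^sup>+q. ennreal ((1 - exp (y * q) + y * q * exp (y * q)) / y\<^sup>2) \<partial>\<nu>)"
    using AE_negative inner by (intro arg_cong[where f = enn2real] nn_integral_cong_AE) auto
  also have "\<dots> = (LINT q|\<nu>. (1 - exp (y * q) + y * q * exp (y * q)) / y\<^sup>2)"
  proof (rule integral_eq_nn_integral[symmetric])
    show "AE q in \<nu>. 0 \<le> (1 - exp (y * q) + y * q * exp (y * q)) / y\<^sup>2"
    proof (rule AE_I2)
      fix q
      have "exp (y * q) * (1 + - (y * q)) \<le> exp (y * q) * exp (- (y * q))"
        by (intro mult_left_mono exp_ge_add_one_self) auto
      then show "0 \<le> (1 - exp (y * q) + y * q * exp (y * q)) / y\<^sup>2"
        by (simp add: algebra_simps flip: exp_add)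
    qed
  qed measurable
  finally have "y\<^sup>2 * (LBINT r:{..<0}. exp (y * r) * r * measure \<nu> {..<r}) =
      - (LINT q|\<nu>. 1 - exp (y * q) + y * q * exp (y * q))"
    using assms by simp
  then show ?thesis
    by (simp add: algebra_simps flip: Bochner_Integration.integral_minus)
qed

subsection \<open>Saddle point analysis\<close>


text \<open>The fully compensated jump exponent, at \<i>\<theta>, of the Esscher-tilted measure with
  density \<open>exp (y * r)\<close> relative to \<open>\<nu>\<close>. For \<open>y > 0\<close> the
  tilt makes r^2 integrable, so the compensator needs no truncation.\<close>

definition tilted_remainder :: "real \<Rightarrow> real \<Rightarrow> complex" where
  "tilted_remainder y \<theta> = (LINT r|\<nu>. exp (y * r) *\<^sub>R (iexp (\<theta> * r) - 1 - \<i> * (\<theta> * r)))"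

text \<open>The truncation terms cancel, so integrability of the tilted integrand is inherited from
  the kernels.\<close>

lemma jump_kernel_increment:
  "exp (y * r) *\<^sub>R (iexp (\<theta> * r) - 1 - \<i> * (\<theta> * r)) =
    jump_kernel (Complex y \<theta>) r - jump_kernel (complex_of_real y) r -
      \<i> * \<theta> * jump_kernel' (complex_of_real y) r"
  by (simp add: jump_kernel_def jump_kernel'_def Complex_eq algebra_simps exp_add
      scaleR_conv_of_real flip: exp_of_real)

text \<open>Subtracting the first-order term removes the drift and the mixed term of the quadratic
  part, leaving the pure square in \<theta> and the compensated jumps.\<close>

lemma levy_exponent_vertical_increment:
  assumes "y > 0"
  shows "levy_exponent b \<sigma> \<nu> (Complex y \<theta>) - levy_exponent b \<sigma> \<nu> (complex_of_real y) -
      \<i> * \<theta> * deriv (levy_exponent b \<sigma> \<nu>) y = - of_real (\<sigma>\<^sup>2 / 2 * \<theta>\<^sup>2) + tilted_remainder y \<theta>"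
proof -
  have tilted_remainder_eq: "tilted_remainder y \<theta> =
      jump_exponent (Complex y \<theta>) - jump_exponent (complex_of_real y) - \<i> * \<theta> * jump_exponent' (complex_of_real y)"
    unfolding tilted_remainder_def jump_kernel_increment jump_exponent_def jump_exponent'_def
    using assms integrable_jump_kernel[of "Complex y \<theta>"]
      integrable_jump_kernel[of "complex_of_real y"] integrable_jump_kernel'[of "complex_of_real y"]
    by simp
  show ?thesis
    unfolding tilted_remainder_eq levy_exponent_complex
      of_real_deriv_levy_exponent[OF assms] Complex_eq
    by (simp add: field_simps power2_eq_square)
qed

text \<open>The integrand has real part \<open>exp (y * r) * (cos (\<theta> * r) - 1)\<close>. This
  sign later gives a Gaussian majorant independent of \<open>y\<close>.\<close>

lemma Re_tilted_remainder_nonpos: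
  assumes "y > 0"
  shows "Re (tilted_remainder y \<theta>) \<le> 0"
proof -
  have int: "integrable \<nu> (\<lambda>r. exp (y * r) *\<^sub>R (iexp (\<theta> * r) - 1 - \<i> * (\<theta> * r)))"
    unfolding jump_kernel_increment using assms integrable_jump_kernel[of "Complex y \<theta>"]
      integrable_jump_kernel[of "complex_of_real y"] integrable_jump_kernel'[of "complex_of_real y"]
    by simp
  have "Re (tilted_remainder y \<theta>) =
      (LINT r|\<nu>. Re (exp (y * r) *\<^sub>R (iexp (\<theta> * r) - 1 - \<i> * (\<theta> * r))))"
    unfolding tilted_remainder_def using int by (rule integral_Re[symmetric])
  also have "\<dots> \<le> (LINT r|\<nu>. 0)"
    using int by (intro integral_mono integrable_Re) (auto simp: Re_exp mult_nonneg_nonpos)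
  finally show ?thesis by simp
qed

text \<open>A majorant independent of \<open>y\<close>, for the limit of large \<open>y\<close>. It
  is written with \<open>1 * r\<close> to match \<open>integrable_square_exp\<close> at c =
  1.\<close>

lemma norm_tilted_remainder_integrand_le:
  assumes "y \<ge> 1" "r < 0"
  shows "norm (exp (y * r) *\<^sub>R (iexp (\<theta> * r) - 1 - \<i> * (\<theta> * r))) \<le> \<theta>\<^sup>2 * (r\<^sup>2 * exp (1 * r))"
proof -
  have "exp (y * r) \<le> exp r" using assms by simp
  then have "exp (y * r) * norm (iexp (\<theta> * r) - 1 - \<i> * (\<theta> * r)) \<le> exp r * (\<theta> * r)\<^sup>2"
    using norm_exp_minus_one_minus_le[of "\<i> * (\<theta> * r)"]
    by (intro mult_mono) (auto simp: norm_mult power2_abs abs_mult[symmetric] simp del: of_real_mult)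
  then show ?thesis by (simp add: power_mult_distrib mult_ac)
qed

text \<open>This is where one-sidedness of the jumps drives the asymptotics: for
  \<open>r < 0\<close> the tilt \<open>exp (y * r)\<close> tends to 0.\<close>

lemma tilted_remainder_tendsto_0: "((\<lambda>y. tilted_remainder y \<theta>) \<longlongrightarrow> 0) at_top"
proof -
  have "((\<lambda>y. tilted_remainder y \<theta>) \<longlongrightarrow> (LINT r|\<nu>. 0)) at_top"
    unfolding tilted_remainder_def
  proof (rule integral_dominated_convergence_at_top)
    show "integrable \<nu> (\<lambda>r. \<theta>\<^sup>2 * (r\<^sup>2 * exp (1 * r)))"
      by (intro integrable_mult_right integrable_square_exp) simp
    show "AE r in \<nu>. ((\<lambda>y. exp (y * r) *\<^sub>R (iexp (\<theta> * r) - 1 - \<i> * (\<theta> * r))) \<longlongrightarrow> 0) at_top"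
      using AE_negative
    proof eventually_elim
      case (elim r)
      have "((\<lambda>y. exp (y * r)) \<longlongrightarrow> 0) at_top"
        using filterlim_tendsto_neg_mult_at_bot[OF tendsto_const elim filterlim_ident]
        by (intro filterlim_compose[OF exp_at_bot]) (simp add: mult.commute)
      from tendsto_scaleR[OF this tendsto_const] show ?case by simp
    qed
    show "\<forall>\<^sub>F y in at_top. AE r in \<nu>. norm (exp (y * r) *\<^sub>R (iexp (\<theta> * r) - 1 - \<i> * (\<theta> * r)))
        \<le> \<theta>\<^sup>2 * (r\<^sup>2 * exp (1 * r))"
      using eventually_ge_at_top[of 1]
    proof eventually_elim
      case (elim y)
      show ?case using AE_negative by eventually_elim (rule norm_tilted_remainder_integrand_le[OF elim])
    qed
  qed measurable
  then show ?thesis by simp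
qed

text \<open>The drift cancels, the Gaussian part leaves one half minus one times \<sigma>^2 y^2, and
  the jump part is the integral evaluated by \<open>jump_tail_identity\<close>. The computation runs
  in the complex numbers to reuse the integrability of the kernels.\<close>

lemma levy_exponent_legendre:
  assumes "y > 0"
  shows "levy_exponent b \<sigma> \<nu> y - y * deriv (levy_exponent b \<sigma> \<nu>) y =
    - (1 / 2) * \<sigma>\<^sup>2 * y\<^sup>2 + y\<^sup>2 * (LBINT r:{..<0}. exp (y * r) * r * measure \<nu> {..<r})"
proof -
  have jump_kernel_eq: "complex_of_real (exp (y * r) - 1 - y * r * exp (y * r)) =
      jump_kernel (complex_of_real y) r - y * jump_kernel' (complex_of_real y) r" for r
    by (simp add: jump_kernel_def jump_kernel'_def algebra_simps flip: exp_of_real)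
  have "complex_of_real (LINT r|\<nu>. exp (y * r) - 1 - y * r * exp (y * r)) =
      jump_exponent (complex_of_real y) - y * jump_exponent' (complex_of_real y)"
    unfolding integral_complex_of_real[symmetric] jump_kernel_eq jump_exponent_def jump_exponent'_def
    using assms integrable_jump_kernel[of "complex_of_real y"]
      integrable_jump_kernel'[of "complex_of_real y"]
    by simp
  moreover have "complex_of_real (levy_exponent b \<sigma> \<nu> y - y * deriv (levy_exponent b \<sigma> \<nu>) y) =
      complex_of_real (- (1 / 2) * \<sigma>\<^sup>2 * y\<^sup>2) +
        (jump_exponent (complex_of_real y) - y * jump_exponent' (complex_of_real y))"
    unfolding of_real_diff of_real_mult of_real_levy_exponent of_real_deriv_levy_exponent[OF assms]
      levy_exponent_complex
    by (simp add: field_simps power2_eq_square)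
  ultimately have "complex_of_real (levy_exponent b \<sigma> \<nu> y - y * deriv (levy_exponent b \<sigma> \<nu>) y) =
      complex_of_real (- (1 / 2) * \<sigma>\<^sup>2 * y\<^sup>2 + (LINT r|\<nu>. exp (y * r) - 1 - y * r * exp (y * r)))"
    by simp
  then show ?thesis
    unfolding of_real_eq_iff jump_tail_identity[OF assms] .
qed

text \<open>Inversion holds on the imaginary axis, and the Gaussian bound on the strip up to
  \<open>y\<close> permits the shift to real part \<open>y\<close>. The point \<open>x\<close> is
  arbitrary here.\<close>

lemma inversion_on_vertical_line:
  assumes "t > 0" "\<sigma>\<^sup>2 > 0" "y > 0"
    and N: "real_distribution N" "N = density lborel (\<lambda>x. ennreal (f x))"
    and f: "\<And>x. 0 \<le> f x" "continuous_on UNIV f"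
    and char: "\<And>\<theta>. char N \<theta> = exp (of_real t * levy_exponent b \<sigma> \<nu> (\<i> * \<theta>))"
  shows "complex_of_real (f x) = 1 / (2 * pi) *
    (CLBINT \<theta>. exp (of_real t * levy_exponent b \<sigma> \<nu> (Complex y \<theta>) - Complex y \<theta> * of_real x))"
proof -
  interpret N: real_distribution N by (rule N(1))
  let ?c = "t * \<sigma>\<^sup>2 / 2"
  have "?c > 0" using assms by simp
  have gauss_int: "integrable lborel (\<lambda>\<theta>. C * exp (- (?c * \<theta>\<^sup>2)))" for C
    using gaussian_integral[OF \<open>?c > 0\<close>] by (simp add: has_bochner_integral_iff)
  define F where "F x u = exp (of_real t * levy_exponent b \<sigma> \<nu> u - u * of_real x)"
    for x :: real and u :: complex
  have cont: "continuous_on {u. 0 \<le> Re u} (F x)" for x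
    unfolding F_def by (intro continuous_intros continuous_on_levy_exponent)
  have char_F: "iexp (- (\<theta> * x)) * char N \<theta> = F x (Complex 0 \<theta>)" for x \<theta>
    by (simp add: char F_def Complex_eq exp_diff exp_minus field_simps)
  have "integrable lborel (char N)"
  proof -
    \<comment> \<open>The strip degenerates to the imaginary axis, where \<open>F 0\<close> is the
      characteristic function.\<close>
    obtain C where C: "\<And>u. 0 \<le> Re u \<Longrightarrow> Re u \<le> 0 \<Longrightarrow> norm (F 0 u) \<le> C * exp (- (?c * (Im u)\<^sup>2))"
      using exp_levy_exponent_gaussian_bound[of t 0 b \<sigma> 0] \<open>t > 0\<close> unfolding F_def
      by (metis less_imp_le order_refl)
    have "norm (char N \<theta>) \<le> norm (C * exp (- (?c * \<theta>\<^sup>2)))" for \<theta>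
      using C[of "Complex 0 \<theta>"] char_F[of \<theta> 0] by (simp add: order_trans[OF _ abs_ge_self])
    then show ?thesis
      by (intro Bochner_Integration.integrable_bound[OF gauss_int[of C]]) auto
  qed
  then have "complex_of_real (f x) = 1 / (2 * pi) * (CLBINT \<theta>. F x (Complex 0 \<theta>))"
    unfolding char_F[symmetric] using N.continuous_density_inversion N(2) f by blast
  also have "(CLBINT \<theta>. F x (Complex 0 \<theta>)) = (CLBINT \<theta>. F x (Complex y \<theta>))"
  proof -
    obtain C where C: "\<And>u. 0 \<le> Re u \<Longrightarrow> Re u \<le> y \<Longrightarrow> norm (F x u) \<le> C * exp (- (?c * (Im u)\<^sup>2))"
      using exp_levy_exponent_gaussian_bound[of t y b \<sigma> x] \<open>t > 0\<close> \<open>y > 0\<close> unfolding F_def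
      by (metis less_imp_le)
    have lim: "((\<lambda>\<theta>. C * exp (- (?c * \<theta>\<^sup>2))) \<longlongrightarrow> 0) G" if "filterlim (\<lambda>\<theta>::real. \<theta>\<^sup>2) at_top G" for G
    proof -
      have "filterlim (\<lambda>\<theta>. - ?c * \<theta>\<^sup>2) at_bot G"
        using \<open>?c > 0\<close> that by (intro filterlim_tendsto_neg_mult_at_bot[OF tendsto_const]) auto
      from tendsto_mult_right_zero[OF filterlim_compose[OF exp_at_bot this], of C]
      show ?thesis by simp
    qed
    have diff: "F x field_differentiable at u" if "0 < Re u" for u
      using levy_exponent_has_field_derivative[OF that, of b \<sigma>] unfolding F_def field_differentiable_def
      by (fastforce intro!: derivative_eq_intros)
    show ?thesis
    proof (rule vertical_contour_shift[where g = "\<lambda>\<theta>. C * exp (- (?c * \<theta>\<^sup>2))"])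
      show "((\<lambda>\<theta>. C * exp (- (?c * \<theta>\<^sup>2))) \<longlongrightarrow> 0) at_top"
        by (intro lim filterlim_pow_at_top filterlim_ident) simp
      show "((\<lambda>\<theta>. C * exp (- (?c * \<theta>\<^sup>2))) \<longlongrightarrow> 0) at_bot"
        by (intro lim filterlim_pow_at_bot_even filterlim_ident) simp_all
    qed (use \<open>y > 0\<close> C gauss_int diff in \<open>auto intro: continuous_on_subset[OF cont]\<close>)
  qed
  finally show ?thesis by (simp add: F_def)
qed

text \<open>At x = t\<Psi>'(y) the point y is critical for u \<mapsto> t\<Psi>(u) - ux, so the term
  linear in \<theta> disappears and the value at y factors out of the integral.\<close>

lemma density_at_saddle_point:
  fixes b \<sigma> :: real and \<Psi> :: "real \<Rightarrow> real"
  assumes "t > 0" "\<sigma>\<^sup>2 > 0" "y > 0"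
    and N: "real_distribution N" "N = density lborel (\<lambda>x. ennreal (f x))"
    and f: "\<And>x. 0 \<le> f x" "continuous_on UNIV f"
    and char: "\<And>\<theta>. char N \<theta> = exp (of_real t * levy_exponent b \<sigma> \<nu> (\<i> * \<theta>))"
  defines "\<Psi> \<equiv> levy_exponent b \<sigma> \<nu>"
  shows "complex_of_real (f (t * deriv \<Psi> y)) = exp (t * (\<Psi> y - y * deriv \<Psi> y)) *
    (1 / (2 * pi) * (CLBINT \<theta>. exp (of_real t * (tilted_remainder y \<theta> - of_real (\<sigma>\<^sup>2 / 2 * \<theta>\<^sup>2)))))"
proof -
  have "exp (of_real t * levy_exponent b \<sigma> \<nu> (Complex y \<theta>) - Complex y \<theta> * of_real (t * deriv \<Psi> y)) =
      exp (t * (\<Psi> y - y * deriv \<Psi> y)) *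
        exp (of_real t * (tilted_remainder y \<theta> - of_real (\<sigma>\<^sup>2 / 2 * \<theta>\<^sup>2)))" for \<theta>
  proof -
    have levy: "levy_exponent b \<sigma> \<nu> (Complex y \<theta>) =
        of_real (\<Psi> y) + \<i> * \<theta> * deriv \<Psi> y + (tilted_remainder y \<theta> - of_real (\<sigma>\<^sup>2 / 2 * \<theta>\<^sup>2))"
      using levy_exponent_vertical_increment[OF \<open>y > 0\<close>, of b \<sigma> \<theta>]
      unfolding \<Psi>_def of_real_levy_exponent by (simp add: algebra_simps)
    show ?thesis
      unfolding levy unfolding exp_of_real[symmetric] exp_add[symmetric] Complex_eq
      by (intro arg_cong[where f = exp]) (simp add: algebra_simps)
  qed
  with inversion_on_vertical_line[OF assms(1-8), where x = "t * deriv \<Psi> y"]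
  show ?thesis by simp
qed

text \<open>Nonpositivity of the real part of the remainder bounds the integrand by the limiting
  Gaussian itself, and the remainder tends to 0 for each fixed \<theta>.\<close>

lemma saddle_point_integral_tendsto:
  assumes "t > 0" "\<sigma>\<^sup>2 > 0"
  shows "((\<lambda>y. CLBINT \<theta>. exp (of_real t * (tilted_remainder y \<theta> - of_real (\<sigma>\<^sup>2 / 2 * \<theta>\<^sup>2)))) \<longlongrightarrow>
    of_real (sqrt (2 * pi / (t * \<sigma>\<^sup>2)))) at_top"
proof -
  let ?c = "t * \<sigma>\<^sup>2 / 2"
  have "?c > 0" using assms by simp
  note gauss = gaussian_integral[OF this, unfolded has_bochner_integral_iff]
  have "((\<lambda>y. CLBINT \<theta>. exp (of_real t * (tilted_remainder y \<theta> - of_real (\<sigma>\<^sup>2 / 2 * \<theta>\<^sup>2)))) \<longlongrightarrow>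
      (CLBINT \<theta>. of_real (exp (- (?c * \<theta>\<^sup>2))))) at_top"
  proof (rule integral_dominated_convergence_at_top)
    show "integrable lborel (\<lambda>\<theta>. exp (- (?c * \<theta>\<^sup>2)))" using gauss by simp
    show "AE \<theta> in lborel. ((\<lambda>y. exp (of_real t * (tilted_remainder y \<theta> - of_real (\<sigma>\<^sup>2 / 2 * \<theta>\<^sup>2)))) \<longlongrightarrow>
        of_real (exp (- (?c * \<theta>\<^sup>2)))) at_top"
      by (intro AE_I2) (auto intro!: tendsto_eq_intros tilted_remainder_tendsto_0
          simp: exp_of_real[symmetric] mult.assoc)
    show "\<forall>\<^sub>F y in at_top. AE \<theta> in lborel.
        norm (exp (of_real t * (tilted_remainder y \<theta> - of_real (\<sigma>\<^sup>2 / 2 * \<theta>\<^sup>2)))) \<le> exp (- (?c * \<theta>\<^sup>2))"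
      using eventually_gt_at_top[of 0]
    proof eventually_elim
      case (elim y)
      show ?case
        using mult_nonneg_nonpos[OF _ Re_tilted_remainder_nonpos[OF elim], of t] assms(1)
        by (intro AE_I2) (simp add: algebra_simps)
    qed
    have "(\<lambda>\<theta>. tilted_remainder y \<theta>) \<in> borel_measurable lborel" for y
      unfolding tilted_remainder_def by measurable
    then show "(\<lambda>\<theta>. exp (of_real t * (tilted_remainder y \<theta> - of_real (\<sigma>\<^sup>2 / 2 * \<theta>\<^sup>2))))
        \<in> borel_measurable lborel" for y
      by measurable
  qed simp
  then show ?thesis
    unfolding integral_complex_of_real using gauss by (simp add: mult.commute)
qed

end

section \<open>Asymptotics of the density along the curve t\<Psi>'(y)\<close>

theorem corollary2p1:
  fixes M :: "'w measure" and Y :: "real \<Rightarrow> 'w \<Rightarrow> real"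
    and b \<sigma> t :: real and \<nu> :: "real measure" and f :: "real \<Rightarrow> real \<Rightarrow> real"
  assumes "levy_process M Y"
    and "levy_measure \<nu>"
    and "\<sigma> \<ge> 0"
    and "has_characteristic_exponent M Y (levy_exponent b \<sigma> \<nu>)"
    and "\<sigma>\<^sup>2 > 0"
    and "emeasure \<nu> {0<..} = 0"
    and "\<And>s. s > 0 \<Longrightarrow> smooth_density M (Y s) (f s)"
    and "t > 0"
  shows "(\<lambda>y. f t (t * deriv (levy_exponent b \<sigma> \<nu>) y)) \<sim>[at_top]
         (\<lambda>y. 1 / sqrt (2 * pi * \<sigma>\<^sup>2 * t) *
              exp (- (1 / 2) * t * \<sigma>\<^sup>2 * y\<^sup>2 +
                   t * y\<^sup>2 * (LBINT r:{..<0}. exp (y * r) * r * measure \<nu> {..<r})))"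
proof -
  interpret levy_process M Y by (rule assms(1))
  interpret spectrally_negative_levy_measure \<nu>
    using assms(2,6) by unfold_locales
  let ?N = "distr M borel (Y t)"
  let ?J = "\<lambda>y. CLBINT \<theta>. exp (of_real t * (tilted_remainder y \<theta> - of_real (\<sigma>\<^sup>2 / 2 * \<theta>\<^sup>2)))"
  have Y_meas [measurable]: "random_variable borel (Y t)"
    using measurable_process assms(8) by simp
  have density: "\<And>x. 0 \<le> f t x" "\<And>n x. (deriv ^^ n) (f t) differentiable (at x)"
      "distributed M lborel (Y t) (\<lambda>x. ennreal (f t x))"
    using assms(7)[OF assms(8)] unfolding smooth_density_def by auto
  have N: "real_distribution ?N"
    by (rule real_distribution_distr) simp
  have "?N = distr M lborel (Y t)" by (rule distr_cong) auto
  then have N_density: "?N = density lborel (\<lambda>x. ennreal (f t x))"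
    using distributed_distr_eq_density[OF density(3)] by simp
  have cont: "continuous_on UNIV (f t)"
    using density(2)[of 0] by (intro differentiable_imp_continuous_on) (simp add: differentiable_on_def)
  have char: "char ?N \<theta> = exp (of_real t * levy_exponent b \<sigma> \<nu> (\<i> * \<theta>))" for \<theta>
  proof -
    have "char ?N \<theta> = (LINT \<omega>|M. exp (\<i> * \<theta> * of_real (Y t \<omega>)))"
      unfolding char_def by (subst integral_distr) (simp_all add: mult.assoc)
    then show ?thesis
      using assms(4,8) unfolding has_characteristic_exponent_def by simp
  qed
  \<comment> \<open>An exact identity for every \<open>y > 0\<close>: the exponential is already the
    one claimed, so only \<open>?J y\<close> has to be taken to the limit.\<close>
  have f_eq: "complex_of_real (f t (t * deriv (levy_exponent b \<sigma> \<nu>) y)) =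
      complex_of_real (exp (- (1 / 2) * t * \<sigma>\<^sup>2 * y\<^sup>2 +
                   t * y\<^sup>2 * (LBINT r:{..<0}. exp (y * r) * r * measure \<nu> {..<r}))) *
      (1 / (2 * pi) * ?J y)" if "y > 0" for y
  proof -
    have "t * (levy_exponent b \<sigma> \<nu> y - y * deriv (levy_exponent b \<sigma> \<nu>) y) =
        - (1 / 2) * t * \<sigma>\<^sup>2 * y\<^sup>2 + t * y\<^sup>2 * (LBINT r:{..<0}. exp (y * r) * r * measure \<nu> {..<r})"
      unfolding levy_exponent_legendre[OF that] by (simp add: algebra_simps)
    with density_at_saddle_point[OF assms(8,5) that N N_density density(1) cont char]
    show ?thesis by simp
  qed
  let ?g = "\<lambda>y. 1 / sqrt (2 * pi * \<sigma>\<^sup>2 * t) *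
              exp (- (1 / 2) * t * \<sigma>\<^sup>2 * y\<^sup>2 +
                   t * y\<^sup>2 * (LBINT r:{..<0}. exp (y * r) * r * measure \<nu> {..<r}))"
  have "((\<lambda>y. complex_of_real (sqrt (2 * pi * \<sigma>\<^sup>2 * t)) * (1 / (2 * pi) * ?J y)) \<longlongrightarrow>
      complex_of_real (sqrt (2 * pi * \<sigma>\<^sup>2 * t)) *
        (complex_of_real (1 / (2 * pi)) * complex_of_real (sqrt (2 * pi / (t * \<sigma>\<^sup>2))))) at_top"
    by (intro tendsto_mult_left saddle_point_integral_tendsto assms)
  also have "complex_of_real (sqrt (2 * pi * \<sigma>\<^sup>2 * t)) *
        (complex_of_real (1 / (2 * pi)) * complex_of_real (sqrt (2 * pi / (t * \<sigma>\<^sup>2)))) =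
      complex_of_real (sqrt ((2 * pi * \<sigma>\<^sup>2 * t) * (2 * pi / (t * \<sigma>\<^sup>2))) / (2 * pi))"
    by (simp only: real_sqrt_mult) simp
  \<comment> \<open>The normalising root of the claim and the Gaussian integral multiply to 2\<pi>,
    which cancels the inversion constant.\<close>
  also have "sqrt ((2 * pi * \<sigma>\<^sup>2 * t) * (2 * pi / (t * \<sigma>\<^sup>2))) / (2 * pi) = 1"
    using assms(5,8) by (cases "\<sigma> = 0") (simp_all add: real_sqrt_mult real_sqrt_divide)
  finally have "((\<lambda>y. complex_of_real (sqrt (2 * pi * \<sigma>\<^sup>2 * t)) * (1 / (2 * pi) * ?J y)) \<longlongrightarrow>
      complex_of_real 1) at_top" .
  moreover have "\<forall>\<^sub>F y in at_top. complex_of_real (sqrt (2 * pi * \<sigma>\<^sup>2 * t)) * (1 / (2 * pi) * ?J y) =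
      complex_of_real (f t (t * deriv (levy_exponent b \<sigma> \<nu>) y) / ?g y)"
    using eventually_gt_at_top[of 0]
    by eventually_elim (unfold of_real_divide f_eq, simp)
  ultimately have "((\<lambda>y. complex_of_real (f t (t * deriv (levy_exponent b \<sigma> \<nu>) y) / ?g y))
      \<longlongrightarrow> of_real 1) at_top"
    by (rule Lim_transform_eventually)
  then have "((\<lambda>y. f t (t * deriv (levy_exponent b \<sigma> \<nu>) y) / ?g y) \<longlongrightarrow> 1) at_top"
    unfolding tendsto_of_real_iff .
  then show ?thesis
    by (rule asymp_equivI')
qed

end
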